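(* Let $\mathfrak{P} \subset \mathbb{Z}_+$ be the set of all prime numbers. There is a one-to-many correspondence between rectangular $n$-simplices and hypergraphs $G = ([n], E)$ with $\mathfrak{P}$-weighted edges (with weighting denoted $W$) such that, for all $p \in \mathfrak{P}$, the set of edges of the partial hypergraph generated by $W^{-1}(p)$ is totally ordered by inclusion. This correspondence is one-to-one after quotienting the right-hand side (the collection of such weighted hypergraphs) by the equivalence relation $\sim_{[n],\mathfrak{P}}$.
   Context: $\mathbb{Z}_+$ is the set of positive integers, $n\in\mathbb{Z}_+$, and $[n]=\{1,\dots,n\}$. For $\lambda=(\lambda_1,\dots,\lambda_n)\in\mathbb{Z}_+^n$, the rectangular simplex ($n$-simplex) $\Delta(\lambda) \subset \mathbb{R}^n$ is the convex hull of $\{0,\lambda_1 e_1,\dots,\lambda_n e_n\}$, where $\{e_i\}$ is the canonical basis of $\mathbb{R}^n$. A hypergraph is a pair $G=(V,E)$ where $V$ is a non-empty finite set (of vertices) and $E$ is a finite sequence of non-empty subsets of $V$ (the edges), i.e. a map $E : I \to \mathcal{P}(V)\setminus\{\emptyset\}$ from a finite, possibly empty, index set $I$, where $\mathcal{P}(V)$ is the power set of $V$ (so edges may repeat and may consist of one vertex). The partial hypergraph generated by $I'\subseteq I$ is $(V,E|_{I'})$. For $S \subseteq \mathbb{Z}_+$, an $S$-weighting on the edges of $G$ is a map $W: I \to S$. Two $S$-weighted hypergraphs on $V$, $(V, E_1: I_1\to\mathcal{P}(V))$ with $W_1: I_1\to S$ and $(V, E_2: I_2\to\mathcal{P}(V))$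 with $W_2:I_2\to S$, are related by $\sim_{V,S}$ if and only if there exists a bijection $f : I_1\to I_2$ with $E_1 = E_2\circ f$ and $W_1 = W_2\circ f$; this is an equivalence relation. *)

theory Defs
  imports "HOL-Analysis.Analysis" "HOL-Computational_Algebra.Primes"
begin

text \<open>
  Coordinates of \<open>\<real>\<^sup>n\<close> are indexed by a finite type \<open>'n\<close> with \<open>n = CARD('n)\<close> (automatically positive),
  so the vertex set \<open>[n]\<close> is \<open>UNIV :: 'n set\<close>.
\<close>

definition rect_simplex :: "nat ^ 'n \<Rightarrow> (real ^ 'n) set" where
  "rect_simplex l = convex hull (insert 0 (range (\<lambda>i. real (l $ i) *\<^sub>R axis i 1)))"

definition rect_simplices :: "(real ^ 'n) set set" where
  "rect_simplices = rect_simplex ` {l. \<forall>i. 0 < l $ i}"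

record ('v, 'i) hypergraph =
  verts :: "'v set"
  index :: "'i set"
  edge :: "'i \<Rightarrow> 'v set"

text \<open>
  Maps out of an index set are extensional (equal to \<open>undefined\<close> outside it), so that equality of
  hypergraphs and of weightings is equality of set-theoretic maps. Index sets are finite subsets of
  \<open>'i\<close>; when \<open>'i\<close> is infinite, every finite index set occurs up to bijection.
\<close>

definition is_hypergraph :: "('v, 'i) hypergraph \<Rightarrow> bool" where
  "is_hypergraph G \<longleftrightarrow> finite (verts G) \<and> verts G \<noteq> {} \<and> finite (index G) \<and>
     edge G \<in> index G \<rightarrow>\<^sub>E (Pow (verts G) - {{}})"

definition partial_hypergraph :: "('v, 'i) hypergraph \<Rightarrow> 'i set \<Rightarrow> ('v, 'i) hypergraph" where
  "partial_hypergraph G J = \<lparr>verts = verts G, index = J, edge = restrict (edge G) J\<rparr>"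

definition edge_set :: "('v, 'i) hypergraph \<Rightarrow> 'v set set" where
  "edge_set G = edge G ` index G"

definition weighted_hypergraphs ::
    "'v set \<Rightarrow> nat set \<Rightarrow> (('v, 'i) hypergraph \<times> ('i \<Rightarrow> nat)) set" where
  "weighted_hypergraphs V S =
     {(G, W). is_hypergraph G \<and> verts G = V \<and> W \<in> index G \<rightarrow>\<^sub>E S}"

definition weighted_sim ::
    "'v set \<Rightarrow> nat set \<Rightarrow> (('v, 'i) hypergraph \<times> ('i \<Rightarrow> nat)) rel" where
  "weighted_sim V S =
     {((G1, W1), (G2, W2)).
        (G1, W1) \<in> weighted_hypergraphs V S \<and> (G2, W2) \<in> weighted_hypergraphs V S \<and>
        (\<exists>f. bij_betw f (index G1) (index G2) \<and>
             (\<forall>j \<in> index G1. edge G1 j = edge G2 (f j)) \<and>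
             (\<forall>j \<in> index G1. W1 j = W2 (f j)))}"

lemma equiv_weighted_sim: "equiv (weighted_hypergraphs V S) (weighted_sim V S)"
proof (rule equivI)
  show "weighted_sim V S \<subseteq> weighted_hypergraphs V S \<times> weighted_hypergraphs V S"
    by (auto simp: weighted_sim_def)
  show "refl_on (weighted_hypergraphs V S) (weighted_sim V S)"
    by (auto simp: refl_on_def weighted_sim_def intro!: exI[of _ id])
  show "sym (weighted_sim V S)"
  proof (rule symI)
    fix a b assume ab: "(a, b) \<in> weighted_sim V S"
    obtain G1 W1 G2 W2 where eq: "a = (G1, W1)" "b = (G2, W2)" by (cases a, cases b) auto
    from ab obtain f where f: "bij_betw f (index G1) (index G2)"
      "\<forall>j \<in> index G1. edge G1 j = edge G2 (f j)" "\<forall>j \<in> index G1. W1 j = W2 (f j)"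
      and mem: "a \<in> weighted_hypergraphs V S" "b \<in> weighted_hypergraphs V S"
      by (auto simp: weighted_sim_def eq)
    let ?g = "inv_into (index G1) f"
    have g: "bij_betw ?g (index G2) (index G1)" by (rule bij_betw_inv_into[OF f(1)])
    have "?g j \<in> index G1 \<and> f (?g j) = j" if "j \<in> index G2" for j
      using g that f(1) by (auto simp: bij_betw_inv_into_right dest: bij_betwE)
    then show "(b, a) \<in> weighted_sim V S"
      using f g mem by (auto simp: weighted_sim_def eq intro!: exI[of _ ?g])
  qed
  show "trans (weighted_sim V S)"
  proof (rule transI)
    fix a b c assume ab: "(a, b) \<in> weighted_sim V S" and bc: "(b, c) \<in> weighted_sim V S"
    obtain G1 W1 G2 W2 G3 W3 where eq: "a = (G1, W1)" "b = (G2, W2)" "c = (G3, W3)"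
      by (cases a, cases b, cases c) auto
    from ab obtain f where f: "bij_betw f (index G1) (index G2)"
      "\<forall>j \<in> index G1. edge G1 j = edge G2 (f j)" "\<forall>j \<in> index G1. W1 j = W2 (f j)"
      by (auto simp: weighted_sim_def eq)
    from bc obtain g where g: "bij_betw g (index G2) (index G3)"
      "\<forall>j \<in> index G2. edge G2 j = edge G3 (g j)" "\<forall>j \<in> index G2. W2 j = W3 (g j)"
      by (auto simp: weighted_sim_def eq)
    have "bij_betw (g \<circ> f) (index G1) (index G3)" using f g by (blast intro: bij_betw_trans)
    moreover have "f j \<in> index G2" if "j \<in> index G1" for j
      using f(1) that by (auto dest: bij_betwE)
    ultimately show "(a, c) \<in> weighted_sim V S"
      using ab bc f g by (auto simp: weighted_sim_def eq intro!: exI[of _ "g \<circ> f"])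
  qed
qed

definition chain_prime_hypergraphs :: "(('n::finite, 'i) hypergraph \<times> ('i \<Rightarrow> nat)) set" where
  "chain_prime_hypergraphs =
     {(G, W) \<in> weighted_hypergraphs UNIV {p. prime p}.
        \<forall>p. prime p \<longrightarrow>
          chain\<^sub>\<subseteq> (edge_set (partial_hypergraph G {j \<in> index G. W j = p}))}"

text \<open>
  The correspondence reads off the \<open>i\<close>-th edge length of the simplex as the product of the weights
  of all edges containing the vertex \<open>i\<close>. For a prime \<open>p\<close> and \<open>k \<ge> 1\<close>, the edges of weight \<open>p\<close>
  are thus the nonempty sets among \<open>{i. p ^ k dvd l $ i}\<close>.
\<close>

definition simplex_hypergraph_corr ::
    "((real ^ 'n) set \<times> (('n::finite, 'i) hypergraph \<times> ('i \<Rightarrow> nat))) set" where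
  "simplex_hypergraph_corr =
     {(rect_simplex l, (G, W)) | l G W.
        (\<forall>i. 0 < l $ i) \<and> (G, W) \<in> chain_prime_hypergraphs \<and>
        (\<forall>i. l $ i = (\<Prod>j \<in> {j \<in> index G. i \<in> edge G j}. W j))}"

end

theory Submission
  imports Defs
begin

text \<open>
  The edge lengths of a simplex are its coordinatewise maxima, so it remains to recover a weighted
  hypergraph, up to reindexing, from the vector of products of weights. For a prime \<open>p\<close> the exponent
  of \<open>p\<close> in the \<open>i\<close>-th product is the degree of \<open>i\<close> in the partial hypergraph of weight \<open>p\<close>. When the
  edges of that hypergraph form a chain, the number of edges containing a nonempty set \<open>e\<close> is the
  minimum of the degrees of the points of \<open>e\<close>; subtracting the edges strictly above \<open>e\<close> gives the
  multiplicity of \<open>e\<close>. Conversely, the sets \<open>{i. p ^ k dvd l $ i}\<close> realise a given vector \<open>l\<close>.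
\<close>

section \<open>Edge lengths as coordinatewise maxima\<close>

lemma rect_simplex_nth_le:
  assumes "x \<in> rect_simplex l"
  shows "x $ i \<le> real (l $ i)"
proof -
  have "convex {x :: real ^ 'a. x $ i \<le> real (l $ i)}"
    by (auto simp: convex_def intro: convex_bound_le)
  \<comment> \<open>A convex set containing all the generators, including 0, contains their
    hull.\<close>
  then have "rect_simplex l \<subseteq> {x. x $ i \<le> real (l $ i)}"
    unfolding rect_simplex_def by (intro hull_minimal) (auto simp: axis_def)
  with assms show ?thesis by auto
qed

lemma axis_in_rect_simplex: "real (l $ i) *\<^sub>R axis i 1 \<in> rect_simplex l"
  unfolding rect_simplex_def by (intro hull_inc) auto

lemma inj_rect_simplex: "inj rect_simplex"
proof (rule injI)
  \<comment> \<open>The vertex of one simplex on the \<open>i\<close>-th axis lies in the other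
    simplex, where the \<open>i\<close>-th coordinate is at most \<open>m $ i\<close>; exchanging
    the two gives the reverse inequality.\<close>
  have le: "l $ i \<le> m $ i" if "rect_simplex l = rect_simplex m" for l m :: "nat ^ 'a" and i
    using rect_simplex_nth_le[of "real (l $ i) *\<^sub>R axis i 1" m i] axis_in_rect_simplex[of l i] that
    by simp
  fix l m :: "nat ^ 'a"
  assume "rect_simplex l = rect_simplex m"
  then show "l = m" by (simp add: vec_eq_iff le antisym)
qed

section \<open>Prime exponents and prime power divisors\<close>

lemma multiplicity_prod_primes:
  fixes f :: "'a \<Rightarrow> nat"
  assumes "finite A" "\<And>a. a \<in> A \<Longrightarrow> prime (f a)" "prime p"
  shows "multiplicity p (\<Prod>a\<in>A. f a) = card {a \<in> A. f a = p}"
proof -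
  have "0 \<notin> f ` A" using assms(2) by (metis imageE not_prime_0)
  then have "multiplicity p (\<Prod>a\<in>A. f a) = (\<Sum>a\<in>A. multiplicity p (f a))"
    using assms by (intro prime_elem_multiplicity_prod_distrib) auto
  also have "\<dots> = (\<Sum>a\<in>A. if f a = p then 1 else 0)"
    using assms by (intro sum.cong) (auto simp: prime_multiplicity_other)
  also have "\<dots> = card {a \<in> A. f a = p}"
    using assms by (simp add: sum.If_cases Int_def)
  finally show ?thesis .
qed

text \<open>A prime \<open>p\<close> occurs in one pair for each \<open>k\<close> from 1 to its
  exponent in \<open>n\<close>, so grouping the pairs by \<open>p\<close> yields the prime
  factorisation. These pairs later label the edges through a vertex.\<close>

lemma prod_prime_power_divisors:
  fixes n :: nat
  assumes "0 < n"
  shows "(\<Prod>(p, k)\<in>{(p, k). prime p \<and> 1 \<le> k \<and> p ^ k dvd n}. p) = n"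
proof -
  have "{(p, k). prime p \<and> 1 \<le> k \<and> p ^ k dvd n} =
      (SIGMA p:prime_factors n. {1..multiplicity p n})" (is "?L = ?R")
  proof (intro set_eqI iffI; clarsimp)
    fix p k assume *: "prime p" "Suc 0 \<le> k" "p ^ k dvd n"
    then have "k \<le> multiplicity p n"
      using assms by (intro multiplicity_geI) (auto simp: prime_gt_Suc_0_nat)
    moreover have "p dvd n" using * dvd_trans[OF dvd_power[of k p]] by auto
    ultimately show "p \<in> prime_factors n \<and> k \<le> multiplicity p n"
      using * assms by (auto simp: prime_factors_dvd)
  qed (auto simp: prime_factors_dvd multiplicity_dvd')
  then have "(\<Prod>(p, k)\<in>?L. p) = (\<Prod>(p, k)\<in>?R. p)" by (rule arg_cong)
  also have "\<dots> = (\<Prod>p\<in>prime_factors n. \<Prod>k\<in>{1..multiplicity p n}. p)"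
    by (subst prod.Sigma) auto
  also have "\<dots> = n" using assms prime_factorization_nat[of n] by simp
  finally show ?thesis .
qed

lemma finite_prime_power_divisors:
  fixes n :: nat
  assumes "0 < n"
  shows "finite {(p, k). prime p \<and> 1 \<le> k \<and> p ^ k dvd n}"
proof (rule finite_subset)
  show "{(p, k). prime p \<and> 1 \<le> k \<and> p ^ k dvd n} \<subseteq> {..n} \<times> {..n}"
  proof clarsimp
    fix p k assume *: "prime p" "Suc 0 \<le> k" "p ^ k dvd n"
    then have "p ^ k \<le> n" using assms by (auto intro: dvd_imp_le)
    moreover have "p ^ 1 \<le> p ^ k" using * prime_ge_1_nat by (intro power_increasing) auto
    moreover have "k < p ^ k" using * prime_gt_Suc_0_nat by (intro power_gt_expt) auto
    ultimately show "p \<le> n \<and> k \<le> n" by simp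
  qed
qed simp

section \<open>Counting edges in fibres and chains\<close>

text \<open>Bijections between corresponding fibres are glued together. With \<open>f\<close> and
  \<open>g\<close> recording weight and edge, this supplies the reindexing that
  \<open>weighted_sim\<close> asks for.\<close>

lemma bij_betw_if_card_fibres_eq:
  assumes "finite A" "finite B"
    and card: "\<And>y. card {a \<in> A. f a = y} = card {b \<in> B. g b = y}"
  shows "\<exists>h. bij_betw h A B \<and> (\<forall>a\<in>A. f a = g (h a))"
proof -
  have "\<exists>h. bij_betw h {a \<in> A. f a = y} {b \<in> B. g b = y}" for y
    using assms by (intro finite_same_card_bij) auto
  then obtain h where h: "\<And>y. bij_betw (h y) {a \<in> A. f a = y} {b \<in> B. g b = y}" by metis
  define k where "k a = h (f a) a" for a
  have k: "k a \<in> B \<and> g (k a) = f a" if "a \<in> A" for a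
    using bij_betwE[OF h[of "f a"]] that by (auto simp: k_def)
  have "inj_on k A"
  proof (rule inj_onI)
    fix a b assume ab: "a \<in> A" "b \<in> A" "k a = k b"
    then have "f a = f b" using k by metis
    with ab show "a = b"
      using bij_betw_imp_inj_on[OF h[of "f a"]] by (auto simp: k_def dest: inj_onD)
  qed
  moreover have "B \<subseteq> k ` A"
  proof
    fix b assume "b \<in> B"
    then have "b \<in> h (g b) ` {a \<in> A. f a = g b}"
      using bij_betw_imp_surj_on[OF h[of "g b"]] by auto
    then show "b \<in> k ` A" by (force simp: k_def)
  qed
  ultimately have "bij_betw k A B" using k by (auto simp: bij_betw_def)
  with k show ?thesis by metis
qed

text \<open>In a chain the sets \<open>{j \<in> J. i \<in> E j}\<close> are nested, so the smallest one is their intersection.\<close>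

lemma card_superset_edges_chain:
  assumes "finite J" "finite e" "e \<noteq> {}"
    and chain: "\<And>j k. j \<in> J \<Longrightarrow> k \<in> J \<Longrightarrow> E j \<subseteq> E k \<or> E k \<subseteq> E j"
  shows "card {j \<in> J. e \<subseteq> E j} = Min ((\<lambda>i. card {j \<in> J. i \<in> E j}) ` e)" (is "_ = Min (?d ` e)")
proof -
  have "Min (?d ` e) \<in> ?d ` e" using assms by (intro Min_in) auto
  then obtain i where i: "i \<in> e" "?d i = Min (?d ` e)" by force
  have "{j \<in> J. i \<in> E j} \<subseteq> {j \<in> J. i' \<in> E j}" if i': "i' \<in> e" for i'
  proof (rule ccontr)
    assume "\<not> ?thesis"
    then obtain k where k: "k \<in> J" "i \<in> E k" "i' \<notin> E k" by auto
    \<comment> \<open>An edge through \<open>i'\<close> cannot lie inside \<open>E k\<close>, which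
      misses \<open>i'\<close>, so it contains \<open>E k\<close> and with it \<open>i\<close>; the
      edge \<open>E k\<close> itself makes the inclusion strict.\<close>
    have "{j \<in> J. i' \<in> E j} \<subset> {j \<in> J. i \<in> E j}" using chain k by blast
    then have "?d i' < ?d i" using assms(1) by (intro psubset_card_mono) auto
    moreover have "Min (?d ` e) \<le> ?d i'" using assms i' by auto
    ultimately show False using i by simp
  qed
  then have "{j \<in> J. e \<subseteq> E j} = {j \<in> J. i \<in> E j}" using i(1) by blast
  with i(2) show ?thesis by simp
qed

text \<open>Induction from large sets to small ones, as \<open>card (- e)\<close> drops when
  \<open>e\<close> grows: the edges containing \<open>e\<close> are counted by a minimum of degrees,
  those strictly above \<open>e\<close> by the induction hypothesis. Empty edges contribute to no
  degree, hence \<open>e\<close> is nonempty.\<close>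

lemma card_edge_fibre_chain_cong:
  fixes E :: "'j \<Rightarrow> 'v::finite set" and F :: "'k \<Rightarrow> 'v set"
  assumes fin: "finite J" "finite K" and "e \<noteq> {}"
    and E: "\<And>j k. j \<in> J \<Longrightarrow> k \<in> J \<Longrightarrow> E j \<subseteq> E k \<or> E k \<subseteq> E j"
    and F: "\<And>j k. j \<in> K \<Longrightarrow> k \<in> K \<Longrightarrow> F j \<subseteq> F k \<or> F k \<subseteq> F j"
    and deg: "\<And>i. card {j \<in> J. i \<in> E j} = card {k \<in> K. i \<in> F k}"
  shows "card {j \<in> J. E j = e} = card {k \<in> K. F k = e}"
  using \<open>e \<noteq> {}\<close>
proof (induction "card (- e)" arbitrary: e rule: less_induct)
  case less
  \<comment> \<open>Polymorphic in the index type, since it is applied to both \<open>E\<close> and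
    \<open>F\<close>.\<close>
  have split: "card {a \<in> A. e \<subseteq> f a} =
      card {a \<in> A. f a = e} + (\<Sum>e'\<in>{e'. e \<subset> e'}. card {a \<in> A. f a = e'})"
    if "finite A" for f :: "'a \<Rightarrow> 'v set" and A
  proof -
    have "{a \<in> A. e \<subseteq> f a} = {a \<in> A. f a = e} \<union> (\<Union>e'\<in>{e'. e \<subset> e'}. {a \<in> A. f a = e'})" by auto
    also have "card \<dots> = card {a \<in> A. f a = e} + card (\<Union>e'\<in>{e'. e \<subset> e'}. {a \<in> A. f a = e'})"
      using that by (intro card_Un_disjoint) auto
    also have "card (\<Union>e'\<in>{e'. e \<subset> e'}. {a \<in> A. f a = e'}) =
        (\<Sum>e'\<in>{e'. e \<subset> e'}. card {a \<in> A. f a = e'})"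
      using that by (intro card_UN_disjoint) auto
    finally show ?thesis .
  qed
  have "(\<Sum>e'\<in>{e'. e \<subset> e'}. card {j \<in> J. E j = e'}) =
      (\<Sum>e'\<in>{e'. e \<subset> e'}. card {k \<in> K. F k = e'})"
    using less by (intro sum.cong less.hyps psubset_card_mono) auto
  moreover have "card {j \<in> J. e \<subseteq> E j} = card {k \<in> K. e \<subseteq> F k}"
    using card_superset_edges_chain[of J e E] card_superset_edges_chain[of K e F] fin E F deg
      less.prems by simp
  ultimately show ?case using split[OF fin(1), of E] split[OF fin(2), of F] by simp
qed

section \<open>Edge lengths as a function of the weighted hypergraph\<close>

definition edge_lengths :: "('n::finite, 'i) hypergraph \<times> ('i \<Rightarrow> nat) \<Rightarrow> nat ^ 'n" where
  "edge_lengths H = (\<chi> i. \<Prod>j\<in>{j \<in> index (fst H). i \<in> edge (fst H) j}. snd H j)"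

text \<open>Every weight is prime, so the common weight of two equally weighted edges can serve as
  the \<open>p\<close> of the chain condition.\<close>

lemma chain_prime_hypergraphs_iff:
  "(G, W) \<in> chain_prime_hypergraphs \<longleftrightarrow>
     (G, W) \<in> weighted_hypergraphs UNIV {p. prime p} \<and>
     (\<forall>j\<in>index G. \<forall>k\<in>index G. W j = W k \<longrightarrow> edge G j \<subseteq> edge G k \<or> edge G k \<subseteq> edge G j)"
  (is "?L \<longleftrightarrow> ?H \<and> ?C")
proof -
  have "?C \<longleftrightarrow> (\<forall>p. prime p \<longrightarrow>
      chain\<^sub>\<subseteq> (edge_set (partial_hypergraph G {j \<in> index G. W j = p})))" if ?H
  proof -
    have "prime (W j)" if "j \<in> index G" for j
      using \<open>?H\<close> that by (auto simp: weighted_hypergraphs_def)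
    then show ?thesis
      unfolding chain_subset_def edge_set_def partial_hypergraph_def by simp blast
  qed
  then show ?thesis by (auto simp: chain_prime_hypergraphs_def)
qed

lemma weighted_hypergraphsD:
  assumes "(G, W) \<in> weighted_hypergraphs V S"
  shows "finite (index G)" "\<And>j. j \<in> index G \<Longrightarrow> W j \<in> S" "\<And>j. j \<in> index G \<Longrightarrow> edge G j \<noteq> {}"
  using assms by (auto simp: weighted_hypergraphs_def is_hypergraph_def)

lemma edge_lengths_pos:
  assumes "H \<in> chain_prime_hypergraphs"
  shows "0 < edge_lengths H $ i"
proof -
  obtain G W where H: "H = (G, W)" by (cases H)
  with assms have "prime (W j)" if "j \<in> index G" for j
    using that by (auto simp: chain_prime_hypergraphs_iff dest: weighted_hypergraphsD(2))
  then show ?thesis 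
    by (auto simp: edge_lengths_def H intro!: prod_pos intro: prime_gt_0_nat)
qed

text \<open>Primality of the weights makes all edge lengths positive, so the correspondence is the
  graph of a function of \<open>H\<close>.\<close>

lemma simplex_hypergraph_corr_iff:
  fixes H :: "('n::finite, 'i) hypergraph \<times> ('i \<Rightarrow> nat)"
  shows "(D, H) \<in> simplex_hypergraph_corr \<longleftrightarrow>
     H \<in> chain_prime_hypergraphs \<and> D = rect_simplex (edge_lengths H)"
proof -
  have eq: "(\<forall>i. l $ i = (\<Prod>j\<in>{j \<in> index G. i \<in> edge G j}. W j)) \<longleftrightarrow> l = edge_lengths (G, W)"
    for l :: "nat ^ 'n" and G :: "('n, 'i) hypergraph" and W
    by (simp add: edge_lengths_def vec_eq_iff)
  show ?thesis
    unfolding simplex_hypergraph_corr_def eq by (cases H) (use edge_lengths_pos in blast)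
qed

lemma weighted_sim_edge_lengths:
  assumes "(H1, H2) \<in> weighted_sim V S"
  shows "edge_lengths H1 = edge_lengths H2"
proof -
  obtain G1 W1 G2 W2 where H: "H1 = (G1, W1)" "H2 = (G2, W2)" by (cases H1, cases H2)
  with assms obtain f where f: "bij_betw f (index G1) (index G2)"
    "\<And>j. j \<in> index G1 \<Longrightarrow> edge G1 j = edge G2 (f j)"
    "\<And>j. j \<in> index G1 \<Longrightarrow> W1 j = W2 (f j)"
    by (auto simp: weighted_sim_def)
  have "(\<Prod>j\<in>{j \<in> index G1. i \<in> edge G1 j}. W1 j) = (\<Prod>j\<in>{j \<in> index G2. i \<in> edge G2 j}. W2 j)" for i
  proof -
    \<comment> \<open>Since \<open>f\<close> preserves edges, it restricts to the edges through
      \<open>i\<close>.\<close>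
    have "bij_betw f {j \<in> index G1. i \<in> edge G1 j} {j \<in> index G2. i \<in> edge G2 j}"
      using f(1,2) by (intro bij_betw_Collect) auto
    from prod.reindex_bij_betw[OF this, of W2] show ?thesis
      using f(3) by (simp cong: prod.cong_simp)
  qed
  then show ?thesis by (simp add: edge_lengths_def H)
qed

text \<open>\<open>weighted_sim\<close> relates arbitrary weighted hypergraphs; this keeps the class
  of a chain hypergraph inside \<open>chain_prime_hypergraphs\<close>.\<close>

lemma weighted_sim_chain_prime_hypergraphs:
  assumes "H1 \<in> chain_prime_hypergraphs" "(H1, H2) \<in> weighted_sim UNIV {p. prime p}"
  shows "H2 \<in> chain_prime_hypergraphs"
proof -
  obtain G1 W1 G2 W2 where H: "H1 = (G1, W1)" "H2 = (G2, W2)" by (cases H1, cases H2)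
  with assms obtain f where f: "f ` index G1 = index G2"
    "\<And>j. j \<in> index G1 \<Longrightarrow> edge G1 j = edge G2 (f j)"
    "\<And>j. j \<in> index G1 \<Longrightarrow> W1 j = W2 (f j)"
    and mem: "(G2, W2) \<in> weighted_hypergraphs UNIV {p. prime p}"
    by (auto simp: weighted_sim_def bij_betw_def)
  show ?thesis
    using assms(1) f(2,3) mem unfolding H chain_prime_hypergraphs_iff f(1)[symmetric] by auto
qed

lemma weighted_sim_if_edge_lengths_eq:
  assumes "H1 \<in> chain_prime_hypergraphs" "H2 \<in> chain_prime_hypergraphs"
    and eq: "edge_lengths H1 = edge_lengths H2"
  shows "(H1, H2) \<in> weighted_sim UNIV {p. prime p}"
proof -
  obtain G1 W1 G2 W2 where H: "H1 = (G1, W1)" "H2 = (G2, W2)" by (cases H1, cases H2)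
  note chain1 = assms(1)[unfolded H chain_prime_hypergraphs_iff]
  note chain2 = assms(2)[unfolded H chain_prime_hypergraphs_iff]
  note H1 = weighted_hypergraphsD[OF conjunct1[OF chain1]]
  note H2 = weighted_hypergraphsD[OF conjunct1[OF chain2]]
  have mult: "multiplicity p (edge_lengths (G, W) $ i) =
      card {j \<in> {j \<in> index G. W j = p}. i \<in> edge G j}"
    if "prime p" "finite (index G)" "\<And>j. j \<in> index G \<Longrightarrow> W j \<in> {p. prime p}"
    for p i and G :: "('a, 'c) hypergraph" and W
  proof -
    have "multiplicity p (edge_lengths (G, W) $ i) =
        card {j \<in> {j \<in> index G. i \<in> edge G j}. W j = p}"
      using that multiplicity_prod_primes[of "{j \<in> index G. i \<in> edge G j}" W p]
      by (simp add: edge_lengths_def)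
    also have "{j \<in> {j \<in> index G. i \<in> edge G j}. W j = p} =
        {j \<in> {j \<in> index G. W j = p}. i \<in> edge G j}" by auto
    finally show ?thesis .
  qed
  \<comment> \<open>Up to reindexing, a weighted hypergraph is the multiset of its pairs of weight
    and edge, so it suffices to compare the multiplicities of each pair \<open>y\<close>.\<close>
  have "card {j \<in> index G1. (W1 j, edge G1 j) = y} = card {j \<in> index G2. (W2 j, edge G2 j) = y}" for y
  proof (cases "prime (fst y) \<and> snd y \<noteq> {}")
    case False
    \<comment> \<open>A pair with a non-prime weight or an empty edge occurs on neither
      side.\<close>
    then have "{j \<in> index G1. (W1 j, edge G1 j) = y} = {}" "{j \<in> index G2. (W2 j, edge G2 j) = y} = {}"
      using H1 H2 by force+
    then show ?thesis by (simp only:)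
  next
    case True
    obtain p e where y: "y = (p, e)" by (cases y)
    have "card {j \<in> {j \<in> index G1. W1 j = p}. edge G1 j = e} =
        card {j \<in> {j \<in> index G2. W2 j = p}. edge G2 j = e}"
    proof (rule card_edge_fibre_chain_cong)
      show "card {j \<in> {j \<in> index G1. W1 j = p}. i \<in> edge G1 j} =
          card {j \<in> {j \<in> index G2. W2 j = p}. i \<in> edge G2 j}" for i
        using mult[of p G1 W1 i] mult[of p G2 W2 i] H1 H2 True eq by (simp add: y H)
    qed (use H1 H2 chain1 chain2 True y in auto)
    then show ?thesis by (simp add: y conj_assoc)
  qed
  from bij_betw_if_card_fibres_eq[OF H1(1) H2(1) this] show ?thesis
    using chain1 chain2 by (auto simp: weighted_sim_def H)
qed

section \<open>Realising a positive vector by a chain hypergraph\<close>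

text \<open>Each pair \<open>(p, k)\<close> for which \<open>p ^ k\<close> divides some coordinate
  gets its own index, so that equal sets for different \<open>k\<close> survive as repeated edges.
  An infinite index type has room for all these pairs.\<close>

lemma ex_chain_prime_hypergraph_edge_lengths:
  fixes l :: "nat ^ 'n::finite"
  assumes inf: "infinite (UNIV :: 'i set)" and pos: "\<And>i. 0 < l $ i"
  shows "\<exists>H :: ('n, 'i) hypergraph \<times> ('i \<Rightarrow> nat). H \<in> chain_prime_hypergraphs \<and> edge_lengths H = l"
proof -
  \<comment> \<open>The bound \<open>1 \<le> k\<close> excludes \<open>p ^ 0 = 1\<close>, which
    would admit every prime and make \<open>Q i\<close> infinite.\<close>
  define Q where "Q i = {(p, k). prime p \<and> 1 \<le> k \<and> p ^ k dvd l $ i}" for i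
  define P where "P = (\<Union>i. Q i)"
  have "finite P" unfolding P_def Q_def using pos finite_prime_power_divisors by auto
  obtain J :: "'i set" where J: "finite J" "card J = card P"
    using infinite_arbitrarily_large[OF inf] by metis
  then obtain g where g: "bij_betw g J P"
    using \<open>finite P\<close> finite_same_card_bij by metis
  define E where "E j = {i. g j \<in> Q i}" for j
  define G where "G = \<lparr>verts = UNIV, index = J, edge = restrict E J\<rparr>"
  define W where "W = restrict (fst \<circ> g) J"
  have gP: "g j \<in> P" if "j \<in> J" for j using bij_betwE[OF g] that by auto
  have "prime (fst (g j))" "E j \<noteq> {}" if "j \<in> J" for j
    using gP[OF that] by (auto simp: P_def Q_def E_def)
  then have "(G, W) \<in> weighted_hypergraphs UNIV {p. prime p}"
    using J(1) by (auto simp: weighted_hypergraphs_def is_hypergraph_def G_def W_def)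
  moreover have "E j \<subseteq> E k \<or> E k \<subseteq> E j" if "j \<in> J" "k \<in> J" "fst (g j) = fst (g k)" for j k
  proof -
    \<comment> \<open>For a fixed prime, divisibility by a higher power implies divisibility by a
      lower one, so the edges shrink as the exponent grows. Membership of \<open>g b\<close> in
      \<open>P\<close> guarantees that its exponent is at least 1.\<close>
    have sub: "E a \<subseteq> E b" if "a \<in> J" "b \<in> J" "fst (g a) = fst (g b)" "snd (g b) \<le> snd (g a)" for a b
      using that gP[of b]
      by (cases "g a"; cases "g b") (auto simp: E_def P_def Q_def intro: power_le_dvd)
    show ?thesis using sub[of j k] sub[of k j] that by (cases "snd (g j) \<le> snd (g k)") auto
  qed
  ultimately have "(G, W) \<in> chain_prime_hypergraphs"
    unfolding chain_prime_hypergraphs_iff by (simp add: G_def W_def)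
  moreover have "edge_lengths (G, W) $ i = l $ i" for i
  proof -
    \<comment> \<open>The edges through \<open>i\<close> correspond to the pairs in
      \<open>Q i\<close>, so the product of their weights runs over the prime power divisors of
      \<open>l $ i\<close>.\<close>
    have "bij_betw g {j \<in> J. i \<in> E j} (Q i)"
    proof -
      have "Q i \<subseteq> g ` J" using bij_betw_imp_surj_on[OF g] by (auto simp: P_def)
      then show ?thesis
        using bij_betw_imp_inj_on[OF g] by (auto simp: bij_betw_def E_def inj_on_def)
    qed
    then have "(\<Prod>j\<in>{j \<in> J. i \<in> E j}. fst (g j)) = (\<Prod>x\<in>Q i. fst x)"
      by (rule prod.reindex_bij_betw)
    also have "\<dots> = l $ i"
      using prod_prime_power_divisors[OF pos[of i]] by (simp add: Q_def case_prod_unfold)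
    finally show ?thesis by (simp add: edge_lengths_def G_def W_def cong: conj_cong prod.cong_simp)
  qed
  ultimately show ?thesis by (metis vec_eq_iff)
qed

section \<open>Non-uniqueness and the bijection with classes\<close>

text \<open>Varying the index \<open>a\<close> gives distinct hypergraphs with the same edge
  lengths, which witnesses that the correspondence is one-to-many.\<close>

lemma single_edge_in_chain_prime_hypergraphs:
  fixes a :: 'i
  defines "H \<equiv> (\<lparr>verts = UNIV, index = {a}, edge = (\<lambda>j\<in>{a}. UNIV)\<rparr>, \<lambda>j\<in>{a}. 2)"
  shows "H \<in> (chain_prime_hypergraphs :: (('n::finite, 'i) hypergraph \<times> ('i \<Rightarrow> nat)) set)"
    and "edge_lengths H = ((\<chi> i. 2) :: nat ^ 'n)"
proof -
  show "H \<in> (chain_prime_hypergraphs :: (('n, 'i) hypergraph \<times> ('i \<Rightarrow> nat)) set)"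
    unfolding H_def chain_prime_hypergraphs_iff
    by (auto simp: weighted_hypergraphs_def is_hypergraph_def)
  \<comment> \<open>The \<open>undefined\<close> branch is the value of the extensional edge map
    outside \<open>{a}\<close>; the conjunct \<open>j = a\<close> never selects it.\<close>
  have "{j. j = a \<and> i \<in> (if j = a then UNIV else undefined)} = {a}" for i :: 'n by auto
  then show "edge_lengths H = ((\<chi> i. 2) :: nat ^ 'n)"
    by (simp add: edge_lengths_def H_def vec_eq_iff cong: conj_cong)
qed

theorem theorem5p5:
  assumes "infinite (UNIV :: 'i set)"
  shows "(\<forall>D \<in> (rect_simplices :: (real ^ 'n::finite) set set).
            \<exists>H :: ('n, 'i) hypergraph \<times> ('i \<Rightarrow> nat).
              H \<in> chain_prime_hypergraphs \<and> (D, H) \<in> simplex_hypergraph_corr) \<and>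
         (\<forall>H \<in> (chain_prime_hypergraphs :: (('n, 'i) hypergraph \<times> ('i \<Rightarrow> nat)) set).
            \<exists>!D. D \<in> rect_simplices \<and> (D, H) \<in> simplex_hypergraph_corr) \<and>
         (\<exists>D \<in> (rect_simplices :: (real ^ 'n) set set).
            \<exists>H1 H2 :: ('n, 'i) hypergraph \<times> ('i \<Rightarrow> nat).
              H1 \<noteq> H2 \<and> (D, H1) \<in> simplex_hypergraph_corr \<and> (D, H2) \<in> simplex_hypergraph_corr) \<and>
         bij_betw (\<lambda>D. simplex_hypergraph_corr `` {D})
           (rect_simplices :: (real ^ 'n) set set)
           ((chain_prime_hypergraphs :: (('n, 'i) hypergraph \<times> ('i \<Rightarrow> nat)) set)
              // weighted_sim UNIV {p. prime p})"
proof (intro conjI ballI)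
  let ?C = "chain_prime_hypergraphs :: (('n, 'i) hypergraph \<times> ('i \<Rightarrow> nat)) set"
  show ex: "\<exists>H :: ('n, 'i) hypergraph \<times> ('i \<Rightarrow> nat).
      H \<in> chain_prime_hypergraphs \<and> (D, H) \<in> simplex_hypergraph_corr"
    if "D \<in> rect_simplices" for D :: "(real ^ 'n) set"
    using that ex_chain_prime_hypergraph_edge_lengths[OF assms]
    unfolding rect_simplices_def simplex_hypergraph_corr_iff by fastforce
  have simplex: "rect_simplex (edge_lengths H) \<in> rect_simplices" if "H \<in> ?C" for H
    using edge_lengths_pos[OF that] by (auto simp: rect_simplices_def)
  show "\<exists>!D. D \<in> rect_simplices \<and> (D, H) \<in> simplex_hypergraph_corr" if "H \<in> ?C" for H
    using simplex[OF that] that by (auto simp: simplex_hypergraph_corr_iff)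
  show "\<exists>D \<in> (rect_simplices :: (real ^ 'n) set set).
      \<exists>H1 H2 :: ('n, 'i) hypergraph \<times> ('i \<Rightarrow> nat).
        H1 \<noteq> H2 \<and> (D, H1) \<in> simplex_hypergraph_corr \<and> (D, H2) \<in> simplex_hypergraph_corr"
  proof -
    obtain a b :: 'i where "a \<noteq> b"
      using assms by (metis ex_new_if_finite finite.emptyI finite_insert insertCI)
    define H :: "'i \<Rightarrow> ('n, 'i) hypergraph \<times> ('i \<Rightarrow> nat)" where
      "H c = (\<lparr>verts = UNIV, index = {c}, edge = (\<lambda>j\<in>{c}. UNIV)\<rparr>, \<lambda>j\<in>{c}. 2)" for c
    have H: "H c \<in> chain_prime_hypergraphs" "edge_lengths (H c) = (\<chi> i. 2)" for c
      unfolding H_def by (rule single_edge_in_chain_prime_hypergraphs)+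
    have "H a \<noteq> H b" using \<open>a \<noteq> b\<close> by (simp add: H_def)
    with simplex[OF H(1)[of a]] H show ?thesis
      unfolding simplex_hypergraph_corr_iff by metis
  qed
  \<comment> \<open>The hypergraphs attached to one simplex form a single class: by injectivity of
    \<open>rect_simplex\<close> they share their edge lengths, which characterise the class.\<close>
  have fibre: "simplex_hypergraph_corr `` {D} = weighted_sim UNIV {p. prime p} `` {H}"
    if "H \<in> ?C" "(D, H) \<in> simplex_hypergraph_corr" for D H
  proof -
    have "(D, H') \<in> simplex_hypergraph_corr \<longleftrightarrow> H' \<in> ?C \<and> edge_lengths H = edge_lengths H'" for H'
      using that injD[OF inj_rect_simplex] by (auto simp: simplex_hypergraph_corr_iff)
    then show ?thesis
      using that weighted_sim_if_edge_lengths_eq weighted_sim_edge_lengths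
        weighted_sim_chain_prime_hypergraphs by blast
  qed
  show "bij_betw (\<lambda>D. simplex_hypergraph_corr `` {D})
      (rect_simplices :: (real ^ 'n) set set) (?C // weighted_sim UNIV {p. prime p})"
  proof (rule bij_betw_imageI)
    show "inj_on (\<lambda>D. simplex_hypergraph_corr `` {D} :: (('n, 'i) hypergraph \<times> ('i \<Rightarrow> nat)) set)
        rect_simplices"
    proof (rule inj_onI)
      fix D D' :: "(real ^ 'n) set"
      assume D: "D \<in> rect_simplices"
        and eq: "simplex_hypergraph_corr `` {D} =
          (simplex_hypergraph_corr `` {D'} :: (('n, 'i) hypergraph \<times> ('i \<Rightarrow> nat)) set)"
      \<comment> \<open>Fibres are nonempty, and any one member determines its simplex.\<close>
      obtain H :: "('n, 'i) hypergraph \<times> ('i \<Rightarrow> nat)" where "(D, H) \<in> simplex_hypergraph_corr"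
        using ex[OF D] by auto
      moreover from this eq have "(D', H) \<in> simplex_hypergraph_corr" by auto
      ultimately show "D = D'" by (simp add: simplex_hypergraph_corr_iff)
    qed
    show "(\<lambda>D. simplex_hypergraph_corr `` {D}) ` rect_simplices = ?C // weighted_sim UNIV {p. prime p}"
    proof (intro equalityI subsetI)
      fix X assume "X \<in> (\<lambda>D. simplex_hypergraph_corr `` {D} ::
        (('n, 'i) hypergraph \<times> ('i \<Rightarrow> nat)) set) ` rect_simplices"
      then obtain D where D: "D \<in> rect_simplices" "X = simplex_hypergraph_corr `` {D}" by auto
      with ex[OF D(1)] obtain H where "H \<in> ?C" "(D, H) \<in> simplex_hypergraph_corr" by auto
      with D fibre show "X \<in> ?C // weighted_sim UNIV {p. prime p}" by (auto intro: quotientI)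
    next
      fix X assume "X \<in> ?C // weighted_sim UNIV {p. prime p}"
      then obtain H where H: "H \<in> ?C" "X = weighted_sim UNIV {p. prime p} `` {H}"
        by (auto elim: quotientE)
      \<comment> \<open>The class of \<open>H\<close> is the fibre over the simplex with the edge
        lengths of \<open>H\<close>.\<close>
      have "X = simplex_hypergraph_corr `` {rect_simplex (edge_lengths H)}"
        using H by (subst fibre[of H]) (auto simp: simplex_hypergraph_corr_iff)
      with simplex[OF H(1)] show "X \<in> (\<lambda>D. simplex_hypergraph_corr `` {D}) ` rect_simplices" by auto
    qed
  qed
qed

end
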